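(* Let $(A,\phi,\gamma)$ be a monoid with a lax action of a monoid $M$, and let $\mathsf{Groth}(A,\phi,\gamma)$ be its Grothendieck construction. (i) The map $\sigma:\mathsf{Groth}(A,\phi,\gamma)\to M$, $\sigma(m,a)=m$, is a surjective homomorphism, and $$1\to A\xrightarrow{\iota}\mathsf{Groth}(A,\phi,\gamma)\xrightarrow{\sigma}M\to1,\qquad \iota(a)=(1,a),$$ is a short exact sequence of monoids (that is, $\iota$ is an injective homomorphism with image $\sigma^{-1}(1)$ and $\sigma$ is surjective). (ii) Any element of the form $(m,1)$ is $\sigma$-precartesian, and hence $\sigma$ is a prefibration. (iii) Any $\sigma$-precartesian element has the form $(m,a)$, where $a$ is an invertible element of $A$.
   Context: A lax action of a monoid $M$ on a monoid $A$ is given by maps $\phi:A\times M\to A$, $(a,m)\mapsto\phi_m(a)$, and $\gamma:M\times M\to A$, $(m,n)\mapsto\gamma_{m,n}$, such that for all $a,b\in A$ and $m,n,k\in M$: (i) $\phi_1(a)=a$; (ii) $\gamma_{m,n}\phi_n(\phi_m(a))=\phi_{mn}(a)\gamma_{m,n}$; (iii) $\gamma_{mn,k}\phi_k(\gamma_{m,n})=\gamma_{m,nk}\gamma_{n,k}$; (iv) $\gamma_{1,m}=1=\gamma_{m,1}$; (v) $\phi_m(1)=1$ and $\phi_m(ab)=\phi_m(a)\phi_m(b)$. $\mathsf{Groth}(A,\phi,\gamma)$ is the monoid with underlying set $M\times A$ and multiplication $(m,a)(n,b)=(mn,\gamma_{m,n}\phi_n(a)b)$, with identity $(1,1)$. For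 a monoid homomorphism $\sigma:E\to M$ with $\mathrm{Ker}(\sigma)=\sigma^{-1}(1)$, an element $x\in E$ is $\sigma$-precartesian if for every $z\in E$ with $\sigma(z)=\sigma(x)$ there exists a unique $y\in\mathrm{Ker}(\sigma)$ with $z=xy$. $\sigma$ is a prefibration if above every element of $M$ there is a $\sigma$-precartesian element. *)

theory Defs
  imports "HOL-Algebra.Coset"
begin

text \<open>
  The library set \<^const>\<open>hom\<close> only asks for compatibility with multiplication, which for
  monoids does not imply that the identity is preserved.
\<close>

locale monoid_morphism = source: monoid E + target: monoid M
  for E (structure) and M (structure) and \<sigma> +
  assumes hom: "\<sigma> \<in> hom E M"
    and one: "\<sigma> \<one>\<^bsub>E\<^esub> = \<one>\<^bsub>M\<^esub>"

text \<open>
  As \<open>\<phi>\<close> acts from the right (\<open>\<phi>\<^sub>n \<circ> \<phi>\<^sub>m\<close> is compared with \<open>\<phi>\<^sub>m\<^sub>n\<close>), \<open>\<phi> m a\<close> is the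
  curried form of \<open>(a, m) \<mapsto> \<phi>\<^sub>m(a)\<close>; all equations are relativised to the carriers.
\<close>

locale lax_action = A: monoid A + M: monoid M
  for A :: "('a, 'r) monoid_scheme" (structure)
    and M :: "('m, 's) monoid_scheme" (structure)
    and \<phi> :: "'m \<Rightarrow> 'a \<Rightarrow> 'a"
    and \<gamma> :: "'m \<Rightarrow> 'm \<Rightarrow> 'a" +
  assumes phi_closed: "\<lbrakk>m \<in> carrier M; a \<in> carrier A\<rbrakk> \<Longrightarrow> \<phi> m a \<in> carrier A"
    and gamma_closed: "\<lbrakk>m \<in> carrier M; n \<in> carrier M\<rbrakk> \<Longrightarrow> \<gamma> m n \<in> carrier A"
    and phi_one_left: "a \<in> carrier A \<Longrightarrow> \<phi> \<one>\<^bsub>M\<^esub> a = a"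
    and gamma_phi: "\<lbrakk>m \<in> carrier M; n \<in> carrier M; a \<in> carrier A\<rbrakk> \<Longrightarrow>
      \<gamma> m n \<otimes>\<^bsub>A\<^esub> \<phi> n (\<phi> m a) = \<phi> (m \<otimes>\<^bsub>M\<^esub> n) a \<otimes>\<^bsub>A\<^esub> \<gamma> m n"
    and gamma_cocycle: "\<lbrakk>m \<in> carrier M; n \<in> carrier M; k \<in> carrier M\<rbrakk> \<Longrightarrow>
      \<gamma> (m \<otimes>\<^bsub>M\<^esub> n) k \<otimes>\<^bsub>A\<^esub> \<phi> k (\<gamma> m n) = \<gamma> m (n \<otimes>\<^bsub>M\<^esub> k) \<otimes>\<^bsub>A\<^esub> \<gamma> n k"
    and gamma_one_left: "m \<in> carrier M \<Longrightarrow> \<gamma> \<one>\<^bsub>M\<^esub> m = \<one>\<^bsub>A\<^esub>"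
    and gamma_one_right: "m \<in> carrier M \<Longrightarrow> \<gamma> m \<one>\<^bsub>M\<^esub> = \<one>\<^bsub>A\<^esub>"
    and phi_one: "m \<in> carrier M \<Longrightarrow> \<phi> m \<one>\<^bsub>A\<^esub> = \<one>\<^bsub>A\<^esub>"
    and phi_mult: "\<lbrakk>m \<in> carrier M; a \<in> carrier A; b \<in> carrier A\<rbrakk> \<Longrightarrow>
      \<phi> m (a \<otimes>\<^bsub>A\<^esub> b) = \<phi> m a \<otimes>\<^bsub>A\<^esub> \<phi> m b"

definition Groth ::
  "('a, 'r) monoid_scheme \<Rightarrow> ('m, 's) monoid_scheme \<Rightarrow>
    ('m \<Rightarrow> 'a \<Rightarrow> 'a) \<Rightarrow> ('m \<Rightarrow> 'm \<Rightarrow> 'a) \<Rightarrow> ('m \<times> 'a) monoid"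
  where "Groth A M \<phi> \<gamma> =
    \<lparr>carrier = carrier M \<times> carrier A,
     mult = (\<lambda>(m, a) (n, b). (m \<otimes>\<^bsub>M\<^esub> n, \<gamma> m n \<otimes>\<^bsub>A\<^esub> \<phi> n a \<otimes>\<^bsub>A\<^esub> b)),
     one = (\<one>\<^bsub>M\<^esub>, \<one>\<^bsub>A\<^esub>)\<rparr>"

definition short_exact_monoids ::
  "('a, 'r) monoid_scheme \<Rightarrow> ('a \<Rightarrow> 'e) \<Rightarrow> ('e, 't) monoid_scheme \<Rightarrow>
    ('e \<Rightarrow> 'm) \<Rightarrow> ('m, 's) monoid_scheme \<Rightarrow> bool"
  where "short_exact_monoids A \<iota> E \<sigma> M \<longleftrightarrow>
    monoid_morphism A E \<iota> \<and> monoid_morphism E M \<sigma> \<and>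
    inj_on \<iota> (carrier A) \<and>
    \<iota> ` carrier A = kernel E M \<sigma> \<and>
    \<sigma> ` carrier E = carrier M"

definition precartesian ::
  "('e, 't) monoid_scheme \<Rightarrow> ('m, 's) monoid_scheme \<Rightarrow> ('e \<Rightarrow> 'm) \<Rightarrow> 'e \<Rightarrow> bool"
  where "precartesian E M \<sigma> x \<longleftrightarrow>
    x \<in> carrier E \<and>
    (\<forall>z\<in>carrier E. \<sigma> z = \<sigma> x \<longrightarrow> (\<exists>!y. y \<in> kernel E M \<sigma> \<and> z = x \<otimes>\<^bsub>E\<^esub> y))"

definition prefibration ::
  "('e, 't) monoid_scheme \<Rightarrow> ('m, 's) monoid_scheme \<Rightarrow> ('e \<Rightarrow> 'm) \<Rightarrow> bool"
  where "prefibration E M \<sigma> \<longleftrightarrow>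
    monoid_morphism E M \<sigma> \<and>
    (\<forall>m\<in>carrier M. \<exists>x. precartesian E M \<sigma> x \<and> \<sigma> x = m)"

end

theory Submission
  imports Defs
begin

text \<open>
  Unwinding the multiplication of the Grothendieck construction gives
  \<open>(m, a) (1, b) = (m, \<gamma>\<^sub>m\<^sub>,\<^sub>1 \<phi>\<^sub>1(a) b) = (m, a b)\<close>: the kernel of the projection is a copy of \<open>A\<close>,
  and it acts on each fibre, again a copy of \<open>A\<close>, by right multiplication. This is the lemma
  \<open>Groth_mult_kernel\<close>. Hence \<open>(m, a)\<close> is precartesian exactly when \<open>b \<mapsto> a b\<close> is a bijection of
  \<open>A\<close>, and in a monoid this holds exactly when \<open>a\<close> is invertible. The resulting
  equivalence \<open>precartesian_Groth_iff\<close> yields both the precartesian elements \<open>(m, 1)\<close>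
  and the shape of an arbitrary one. That the construction is a monoid at all
  rests on the associativity computation \<open>Groth_assoc_snd\<close>, which combines the cocycle
  condition on \<open>\<gamma>\<close> with the comparison of \<open>\<phi>\<^sub>n \<circ> \<phi>\<^sub>m\<close> and \<open>\<phi>\<^sub>m\<^sub>n\<close> through \<open>\<gamma>\<^sub>m\<^sub>,\<^sub>n\<close>.
\<close>

text \<open>
  A solution of \<open>a b = 1\<close> is a right inverse, and then \<open>a (b a) = a = a 1\<close>, so
  uniqueness of solutions makes it a left inverse as well.
\<close>

lemma (in monoid) Units_iff_left_mult_bijective:
  assumes a: "a \<in> carrier G"
  shows "a \<in> Units G \<longleftrightarrow> (\<forall>c\<in>carrier G. \<exists>!b. b \<in> carrier G \<and> c = a \<otimes> b)"
proof
  assume u: "a \<in> Units G"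
  show "\<forall>c\<in>carrier G. \<exists>!b. b \<in> carrier G \<and> c = a \<otimes> b"
  proof
    fix c assume c: "c \<in> carrier G"
    have "c = a \<otimes> (inv a \<otimes> c)"
      using u a c by (simp add: m_assoc [symmetric])
    moreover have "inv a \<otimes> c \<in> carrier G"
      using u c by simp
    ultimately show "\<exists>!b. b \<in> carrier G \<and> c = a \<otimes> b"
      using u by (intro ex1I [of _ "inv a \<otimes> c"]) (auto simp: m_assoc [symmetric])
  qed
next
  assume bij: "\<forall>c\<in>carrier G. \<exists>!b. b \<in> carrier G \<and> c = a \<otimes> b"
  then obtain b where b: "b \<in> carrier G" and ab: "\<one> = a \<otimes> b"
    by (metis one_closed)
  have "a = a \<otimes> (b \<otimes> a)"
    using a b by (simp add: m_assoc [symmetric] flip: ab)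
  moreover have "a = a \<otimes> \<one>"
    using a by simp
  moreover have "b \<otimes> a \<in> carrier G" "\<one> \<in> carrier G"
    using a b by simp_all
  ultimately have "b \<otimes> a = \<one>"
    using bij a b by blast
  then show "a \<in> Units G"
    using a b ab [symmetric] unfolding Units_def by blast
qed

lemma carrier_Groth [simp]: "carrier (Groth A M \<phi> \<gamma>) = carrier M \<times> carrier A"
  by (simp add: Groth_def)

lemma one_Groth [simp]: "\<one>\<^bsub>Groth A M \<phi> \<gamma>\<^esub> = (\<one>\<^bsub>M\<^esub>, \<one>\<^bsub>A\<^esub>)"
  by (simp add: Groth_def)

lemma mult_Groth [simp]:
  "(m, a) \<otimes>\<^bsub>Groth A M \<phi> \<gamma>\<^esub> (n, b) = (m \<otimes>\<^bsub>M\<^esub> n, \<gamma> m n \<otimes>\<^bsub>A\<^esub> \<phi> n a \<otimes>\<^bsub>A\<^esub> b)"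
  by (simp add: Groth_def)

lemma kernel_Groth_fst:
  assumes "monoid M"
  shows "kernel (Groth A M \<phi> \<gamma>) M fst = {\<one>\<^bsub>M\<^esub>} \<times> carrier A"
  using monoid.one_closed [OF assms] by (auto simp: kernel_def)

context lax_action
begin

text \<open>
  The second components of the two bracketings agree: \<open>\<phi>\<^sub>k\<close> is distributed over
  the inner product, the cocycle condition exchanges the pair of \<open>\<gamma>\<close> factors,
  and \<open>\<gamma>\<^sub>n\<^sub>,\<^sub>k\<close> is then moved past \<open>\<phi>\<^sub>k(\<phi>\<^sub>n(a))\<close>, turning it into \<open>\<phi>\<^sub>n\<^sub>k(a)\<close>.
\<close>

lemma Groth_assoc_snd:
  assumes "m \<in> carrier M" "n \<in> carrier M" "k \<in> carrier M"
    and "a \<in> carrier A" "b \<in> carrier A" "c \<in> carrier A"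
  shows "\<gamma> (m \<otimes>\<^bsub>M\<^esub> n) k \<otimes> \<phi> k (\<gamma> m n \<otimes> \<phi> n a \<otimes> b) \<otimes> c
    = \<gamma> m (n \<otimes>\<^bsub>M\<^esub> k) \<otimes> \<phi> (n \<otimes>\<^bsub>M\<^esub> k) a \<otimes> (\<gamma> n k \<otimes> \<phi> k b \<otimes> c)"
proof -
  note [simp] = assms phi_closed gamma_closed
  have "\<gamma> (m \<otimes>\<^bsub>M\<^esub> n) k \<otimes> \<phi> k (\<gamma> m n \<otimes> \<phi> n a \<otimes> b) \<otimes> c
      = (\<gamma> (m \<otimes>\<^bsub>M\<^esub> n) k \<otimes> \<phi> k (\<gamma> m n)) \<otimes> (\<phi> k (\<phi> n a) \<otimes> (\<phi> k b \<otimes> c))"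
    by (simp add: phi_mult A.m_assoc)
  also have "\<dots> = \<gamma> m (n \<otimes>\<^bsub>M\<^esub> k) \<otimes> (\<gamma> n k \<otimes> \<phi> k (\<phi> n a)) \<otimes> (\<phi> k b \<otimes> c)"
    by (simp add: gamma_cocycle A.m_assoc)
  also have "\<dots> = \<gamma> m (n \<otimes>\<^bsub>M\<^esub> k) \<otimes> \<phi> (n \<otimes>\<^bsub>M\<^esub> k) a \<otimes> (\<gamma> n k \<otimes> \<phi> k b \<otimes> c)"
    by (simp add: gamma_phi A.m_assoc)
  finally show ?thesis .
qed

lemma monoid_Groth: "monoid (Groth A M \<phi> \<gamma>)"
proof (rule monoidI)
  fix x y z
  assume "x \<in> carrier (Groth A M \<phi> \<gamma>)" "y \<in> carrier (Groth A M \<phi> \<gamma>)"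
    "z \<in> carrier (Groth A M \<phi> \<gamma>)"
  then show "x \<otimes>\<^bsub>Groth A M \<phi> \<gamma>\<^esub> y \<otimes>\<^bsub>Groth A M \<phi> \<gamma>\<^esub> z
    = x \<otimes>\<^bsub>Groth A M \<phi> \<gamma>\<^esub> (y \<otimes>\<^bsub>Groth A M \<phi> \<gamma>\<^esub> z)"
    by (cases x; cases y; cases z) (simp add: Groth_assoc_snd M.m_assoc)
qed (auto simp: phi_closed gamma_closed phi_one_left gamma_one_left gamma_one_right phi_one)

lemma Groth_mult_kernel:
  assumes "m \<in> carrier M" "a \<in> carrier A"
  shows "(m, a) \<otimes>\<^bsub>Groth A M \<phi> \<gamma>\<^esub> (\<one>\<^bsub>M\<^esub>, b) = (m, a \<otimes> b)"
  using assms by (simp add: phi_one_left gamma_one_right)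

lemma monoid_morphism_fst: "monoid_morphism (Groth A M \<phi> \<gamma>) M fst"
  unfolding monoid_morphism_def monoid_morphism_axioms_def
  using monoid_Groth M.monoid_axioms by (auto simp: hom_def)

lemma monoid_morphism_inclusion:
  "monoid_morphism A (Groth A M \<phi> \<gamma>) (\<lambda>a. (\<one>\<^bsub>M\<^esub>, a))"
  unfolding monoid_morphism_def monoid_morphism_axioms_def
  using monoid_Groth A.monoid_axioms
  by (auto simp: hom_def phi_one_left gamma_one_right)

lemma image_fst_Groth: "fst ` carrier (Groth A M \<phi> \<gamma>) = carrier M"
  by (auto intro!: image_eqI [where x = "(x, \<one>)" for x])

lemma short_exact_Groth:
  "short_exact_monoids A (\<lambda>a. (\<one>\<^bsub>M\<^esub>, a)) (Groth A M \<phi> \<gamma>) fst M"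
  unfolding short_exact_monoids_def
  using monoid_morphism_inclusion monoid_morphism_fst image_fst_Groth
  by (auto simp: inj_on_def kernel_Groth_fst [OF M.monoid_axioms])

text \<open>
  Every point of the fibre over \<open>m\<close> is some \<open>(m, c)\<close> and every kernel element
  some \<open>(1, b)\<close>, so the equations defining precartesianness are the equations
  \<open>c = a b\<close> in \<open>A\<close>.
\<close>

lemma precartesian_Groth_iff:
  assumes m: "m \<in> carrier M" and a: "a \<in> carrier A"
  shows "precartesian (Groth A M \<phi> \<gamma>) M fst (m, a) \<longleftrightarrow> a \<in> Units A"
proof -
  let ?G = "Groth A M \<phi> \<gamma>"
  have fibre: "(\<exists>!y. y \<in> kernel ?G M fst \<and> (m, c) = (m, a) \<otimes>\<^bsub>?G\<^esub> y)
      \<longleftrightarrow> (\<exists>!b. b \<in> carrier A \<and> c = a \<otimes> b)" for c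
  proof -
    have solution: "y \<in> kernel ?G M fst \<and> (m, c) = (m, a) \<otimes>\<^bsub>?G\<^esub> y
        \<longleftrightarrow> fst y = \<one>\<^bsub>M\<^esub> \<and> snd y \<in> carrier A \<and> c = a \<otimes> snd y" for y
      unfolding kernel_Groth_fst [OF M.monoid_axioms]
      using Groth_mult_kernel [OF m a] by (cases y) (auto simp del: mult_Groth)
    have "(\<exists>!y. fst y = u \<and> P (snd y)) \<longleftrightarrow> (\<exists>!b. P b)"
      for u :: 'm and P :: "'a \<Rightarrow> bool"
      by (metis fst_conv snd_conv prod.expand)
    then show ?thesis
      unfolding solution .
  qed
  have "precartesian ?G M fst (m, a) \<longleftrightarrow>
      (\<forall>c\<in>carrier A. \<exists>!y. y \<in> kernel ?G M fst \<and> (m, c) = (m, a) \<otimes>\<^bsub>?G\<^esub> y)"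
    using m a unfolding precartesian_def by (auto simp del: mult_Groth)
  then show ?thesis
    by (simp only: fibre A.Units_iff_left_mult_bijective [OF a])
qed

lemma precartesian_Groth_one:
  "m \<in> carrier M \<Longrightarrow> precartesian (Groth A M \<phi> \<gamma>) M fst (m, \<one>)"
  by (simp add: precartesian_Groth_iff)

lemma prefibration_Groth: "prefibration (Groth A M \<phi> \<gamma>) M fst"
  unfolding prefibration_def
  using monoid_morphism_fst precartesian_Groth_one by force

lemma precartesian_Groth_form:
  assumes "precartesian (Groth A M \<phi> \<gamma>) M fst x"
  shows "\<exists>m\<in>carrier M. \<exists>a\<in>Units A. x = (m, a)"
proof -
  obtain m a where x: "x = (m, a)" and "m \<in> carrier M" "a \<in> carrier A"
    using assms by (cases x) (auto simp: precartesian_def)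
  then show ?thesis
    using assms precartesian_Groth_iff by blast
qed

end

theorem lemma4p2:
  fixes A :: "('a, 'r) monoid_scheme"
    and M :: "('m, 's) monoid_scheme"
    and \<phi> :: "'m \<Rightarrow> 'a \<Rightarrow> 'a"
    and \<gamma> :: "'m \<Rightarrow> 'm \<Rightarrow> 'a"
  assumes "lax_action A M \<phi> \<gamma>"
  shows "(monoid_morphism (Groth A M \<phi> \<gamma>) M fst \<and>
          fst ` carrier (Groth A M \<phi> \<gamma>) = carrier M \<and>
          short_exact_monoids A (\<lambda>a. (\<one>\<^bsub>M\<^esub>, a)) (Groth A M \<phi> \<gamma>) fst M) \<and>
         ((\<forall>m\<in>carrier M. precartesian (Groth A M \<phi> \<gamma>) M fst (m, \<one>\<^bsub>A\<^esub>)) \<and>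
          prefibration (Groth A M \<phi> \<gamma>) M fst) \<and>
         (\<forall>x. precartesian (Groth A M \<phi> \<gamma>) M fst x \<longrightarrow>
           (\<exists>m\<in>carrier M. \<exists>a\<in>Units A. x = (m, a)))"
proof -
  interpret lax_action A M \<phi> \<gamma> by (fact assms)
  show ?thesis
    using monoid_morphism_fst image_fst_Groth short_exact_Groth precartesian_Groth_one
      prefibration_Groth precartesian_Groth_form
    by blast
qed

end
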